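(* Let $\alpha\in\mathbb{R}$, let $\mathcal{X}$ be a finite state space with passive dynamics $\pi_0$, and consider the $\alpha$-RLC Bellman equations (FH), (FE), (IH) defined in the context. They can be made linear in a transformed value function, as follows. (1) Suppose $\alpha\neq 1$. Put $z^{(\alpha)}=\exp\left(-(1-\alpha)v^{(\alpha)}\right)$ and $Q=\exp\left(-(1-\alpha)q\right)$ (with time index/argument $t$ in the FH case: $z^{(\alpha)}_t(x)=\exp(-(1-\alpha)v^{(\alpha)}_t(x))$, $Q(x,t)=\exp(-(1-\alpha)q(x,t))$). Then a real-valued function $v^{(\alpha)}$ (together with $\bar c\in\mathbb{R}$ in the IH case) satisfies the $\alpha$-RLC Bellman equation if and only if $z^{(\alpha)}$ satisfies the linear equation FH: $z^{(\alpha)}_t(x)=Q(x,t)\,\mathrm{E}_{\pi_0(\cdot|x)}\left[z^{(\alpha)}_{t+1}\right]$ for all $x\in\mathcal{X}$, $0\le t\le T-1$, with $z^{(\alpha)}_T(x)=Q(x,T)$; FE: $z^{(\alpha)}(x)=Q(x)\,\mathrm{E}_{\pi_0(\cdot|x)}\left[z^{(\alpha)}\right]$ for all $x\in\mathcal{N}$, with $z^{(\alpha)}(x)=Q(x)$ for $x\in\mathcal{T}$; IH: $z^{(\alpha)}(x)=Q(x)\exp\left(-(\alpha-1)\bar c\right)\mathrm{E}_{\pi_0(\cdot|x)}\left[z^{(\alpha)}\right]$ for all $x\in\mathcal{X}$. (2) Suppose $\alpha=1$. Then $v^{(1)}$ (together with $\bar c$ in the IH case) satisfies the $\alpha$-RLC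 Bellman equation if and only if it satisfies the linear equation FH: $v^{(1)}_t(x)=q(x,t)+\mathrm{E}_{\pi_0(\cdot|x)}\left[v^{(1)}_{t+1}\right]$ for all $x\in\mathcal{X}$, $0\le t\le T-1$, with $v^{(1)}_T(x)=q(x,T)$; FE: $v^{(1)}(x)=q(x)+\mathrm{E}_{\pi_0(\cdot|x)}\left[v^{(1)}\right]$ for all $x\in\mathcal{N}$, with $v^{(1)}(x)=q(x)$ for $x\in\mathcal{T}$; IH: $v^{(1)}(x)+\bar c=q(x)+\mathrm{E}_{\pi_0(\cdot|x)}\left[v^{(1)}\right]$ for all $x\in\mathcal{X}$. (3) For every $\alpha\in\mathbb{R}$, the optimal control law (the control attaining the minimum in the Bellman equation at state $x$) is $$\pi_{co}^*(x'|x)=\frac{\pi_0(x'|x)\exp\left(-v^{(\alpha)}(x')\right)}{\sum_{y\in\mathcal{X}}\pi_0(y|x)\exp\left(-v^{(\alpha)}(y)\right)},$$ where in the FH case, at time $t$, $v^{(\alpha)}$ is replaced by $v^{(\alpha)}_{t+1}$.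
   Context: $\mathcal{X}$ is a finite set and $\mathcal{P}[\mathcal{X}]$ is the set of probability distributions on $\mathcal{X}$; $\mathrm{supp}[p]=\{x:p(x)>0\}$. The passive dynamics is a map $x\mapsto\pi_0(\cdot|x)\in\mathcal{P}[\mathcal{X}]$. For $p\in\mathcal{P}[\mathcal{X}]$ and $f:\mathcal{X}\to\mathbb{R}$: $\mathrm{E}_p[f]=\sum_x p(x)f(x)$, $\Psi^\alpha_p[f]=\alpha^{-1}\log\left(\mathrm{E}_p[\exp(\alpha f)]\right)$ for $\alpha\neq0$, and $\Psi^0_p[f]=\mathrm{E}_p[f]$. Rényi divergence of order $\alpha\in\mathbb{R}$ (with this paper's normalization): for $\alpha\ne 0,1$, $\mathbb{D}_\alpha(p\|q)=\frac{1}{\alpha(\alpha-1)}\log\left(\sum_{x}p(x)^\alpha q(x)^{1-\alpha}\right)$, the sum being over $x\in\mathrm{supp}[p]\cap\mathrm{supp}[q]$; $\mathbb{D}_0(p\|q)=\mathrm{KL}(q\|p)$ and $\mathbb{D}_1(p\|q)=\mathrm{KL}(p\|q)$, where $\mathrm{KL}(p\|q)=\sum_x p(x)\log\frac{p(x)}{q(x)}$. It is defined when $\mathrm{supp}[p]\cap\mathrm{supp}[q]\neq\emptyset$ if $\alpha\in(0,1)$, when $\mathrm{supp}[p]\subseteq\mathrm{supp}[q]$ if $\alpha\ge1$, and when $\mathrm{supp}[q]\subseteq\mathrm{supp}[p]$ if $\alpha\le0$. Admissible controls at $x$ are probability distributions: $\mathcal{U}_c(x)$ is the set of $u\in\mathcal{P}[\mathcal{X}]$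 for which $\mathbb{D}_\alpha(\pi_0(\cdot|x)\|u)$ is defined, i.e. $\mathrm{supp}[u]\subseteq\mathrm{supp}[\pi_0(\cdot|x)]$ if $\alpha\le0$, $\mathrm{supp}[u]\supseteq\mathrm{supp}[\pi_0(\cdot|x)]$ if $\alpha\ge1$, $\mathrm{supp}[u]\cap\mathrm{supp}[\pi_0(\cdot|x)]\ne\emptyset$ if $0<\alpha<1$. Applying control $u$, the next state is distributed according to $u$. An $\alpha$-RLC (linearly solvable risk-sensitive control problem with risk parameter $\alpha$) has real state cost $q$ and control cost $\mathbb{D}_\alpha(\pi_0(\cdot|x)\|u)$. Its optimal value function $v^{(\alpha)}$ (real-valued) is characterized by the $\alpha$-RLC Bellman equation: (FH, finite horizon $T$, state cost $q(x,t)$): $v^{(\alpha)}_t(x)=q(x,t)+\min_{u\in\mathcal{U}_c(x)}\left\{\mathbb{D}_\alpha(\pi_0(\cdot|x)\|u)+\Psi^\alpha_{u}[v^{(\alpha)}_{t+1}]\right\}$ for $x\in\mathcal{X}$, $0\le t\le T-1$, with $v^{(\alpha)}_T(x)=q(x,T)$. (FE, first exit; $\mathcal{X}$ is the disjoint union of terminal states $\mathcal{T}$ and non-terminal states $\mathcal{N}$, state cost $q(x)$): $v^{(\alpha)}(x)=q(x)+\min_{u\in\mathcal{U}_c(x)}\left\{\mathbb{D}_\alpha(\pi_0(\cdot|x)\|u)+\Psi^\alpha_{u}[v^{(\alpha)}]\right\}$ for $x\in\mathcal{N}$, with $v^{(\alpha)}(x)=q(x)$ for $x\in\mathcal{T}$.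 (IH, infinite-horizon average cost, state cost $q(x)$, unknowns $v^{(\alpha)}$ and the optimal average cost $\bar c\in\mathbb{R}$): $v^{(\alpha)}(x)+\bar c=q(x)+\min_{u\in\mathcal{U}_c(x)}\left\{\mathbb{D}_\alpha(\pi_0(\cdot|x)\|u)+\Psi^\alpha_{u}[v^{(\alpha)}]\right\}$ for $x\in\mathcal{X}$. *)

theory Defs
  imports "HOL-Probability.Probability"
begin

text \<open>
  Distributions on the finite state space are probability mass functions over a type of class
  \<open>finite\<close>; \<open>set_pmf p\<close> is the support of \<open>p\<close>.
\<close>

definition Psi :: "real \<Rightarrow> 'x::finite pmf \<Rightarrow> ('x \<Rightarrow> real) \<Rightarrow> real" where
  "Psi \<alpha> p f =
     (if \<alpha> = 0 then measure_pmf.expectation p f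
      else ln (measure_pmf.expectation p (\<lambda>x. exp (\<alpha> * f x))) / \<alpha>)"

text \<open>
  Where \<open>pmf p x = 0\<close> the summand is 0, as usual. A point with \<open>pmf p x > 0\<close> and \<open>pmf q x = 0\<close>
  would contribute the junk value 0 (because \<open>ln 0 = 0\<close>); \<open>renyi_defined\<close> below excludes this case
  wherever the divergence is used.
\<close>

definition KL :: "'x::finite pmf \<Rightarrow> 'x pmf \<Rightarrow> real" where
  "KL p q = (\<Sum>x\<in>UNIV. pmf p x * ln (pmf p x / pmf q x))"

definition renyi :: "real \<Rightarrow> 'x::finite pmf \<Rightarrow> 'x pmf \<Rightarrow> real" where
  "renyi \<alpha> p q =
     (if \<alpha> = 0 then KL q p
      else if \<alpha> = 1 then KL p q
      else 1 / (\<alpha> * (\<alpha> - 1)) *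
        ln (\<Sum>x \<in> set_pmf p \<inter> set_pmf q. pmf p x powr \<alpha> * pmf q x powr (1 - \<alpha>)))"

definition renyi_defined :: "real \<Rightarrow> 'x::finite pmf \<Rightarrow> 'x pmf \<Rightarrow> bool" where
  "renyi_defined \<alpha> p q \<longleftrightarrow>
     (0 < \<alpha> \<and> \<alpha> < 1 \<longrightarrow> set_pmf p \<inter> set_pmf q \<noteq> {}) \<and>
     (\<alpha> \<ge> 1 \<longrightarrow> set_pmf p \<subseteq> set_pmf q) \<and>
     (\<alpha> \<le> 0 \<longrightarrow> set_pmf q \<subseteq> set_pmf p)"

text \<open>
  In the following, \<open>p\<close> is the passive distribution at the current state and \<open>w\<close> the value function
  at the next step.
\<close>

definition admissible :: "real \<Rightarrow> 'x::finite pmf \<Rightarrow> 'x pmf set" where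
  "admissible \<alpha> p = {u. renyi_defined \<alpha> p u}"

definition objective :: "real \<Rightarrow> 'x::finite pmf \<Rightarrow> ('x \<Rightarrow> real) \<Rightarrow> 'x pmf \<Rightarrow> real" where
  "objective \<alpha> p w u = renyi \<alpha> p u + Psi \<alpha> u w"

definition optimal_control :: "real \<Rightarrow> 'x::finite pmf \<Rightarrow> ('x \<Rightarrow> real) \<Rightarrow> 'x pmf \<Rightarrow> bool" where
  "optimal_control \<alpha> p w u \<longleftrightarrow> is_arg_min (objective \<alpha> p w) (\<lambda>u. u \<in> admissible \<alpha> p) u"

text \<open>
  \<open>is_min_value \<alpha> p w m\<close>: the minimum of the objective over the admissible controls exists (is
  attained) and equals \<open>m\<close>. The Bellman equations are relations because an equation involving an
  infimum of reals would not express attainment.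
\<close>

definition is_min_value :: "real \<Rightarrow> 'x::finite pmf \<Rightarrow> ('x \<Rightarrow> real) \<Rightarrow> real \<Rightarrow> bool" where
  "is_min_value \<alpha> p w m \<longleftrightarrow> (\<exists>u. optimal_control \<alpha> p w u \<and> m = objective \<alpha> p w u)"

definition bellman_FH ::
  "real \<Rightarrow> ('x::finite \<Rightarrow> 'x pmf) \<Rightarrow> nat \<Rightarrow> ('x \<Rightarrow> nat \<Rightarrow> real) \<Rightarrow> (nat \<Rightarrow> 'x \<Rightarrow> real) \<Rightarrow> bool" where
  "bellman_FH \<alpha> \<pi>0 T q v \<longleftrightarrow>
     (\<forall>x. \<forall>t<T. \<exists>m. is_min_value \<alpha> (\<pi>0 x) (v (Suc t)) m \<and> v t x = q x t + m) \<and>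
     (\<forall>x. v T x = q x T)"

definition bellman_FE ::
  "real \<Rightarrow> ('x::finite \<Rightarrow> 'x pmf) \<Rightarrow> 'x set \<Rightarrow> 'x set \<Rightarrow> ('x \<Rightarrow> real) \<Rightarrow> ('x \<Rightarrow> real) \<Rightarrow> bool" where
  "bellman_FE \<alpha> \<pi>0 \<N> \<T> q v \<longleftrightarrow>
     (\<forall>x\<in>\<N>. \<exists>m. is_min_value \<alpha> (\<pi>0 x) v m \<and> v x = q x + m) \<and>
     (\<forall>x\<in>\<T>. v x = q x)"

definition bellman_IH ::
  "real \<Rightarrow> ('x::finite \<Rightarrow> 'x pmf) \<Rightarrow> ('x \<Rightarrow> real) \<Rightarrow> ('x \<Rightarrow> real) \<Rightarrow> real \<Rightarrow> bool" where
  "bellman_IH \<alpha> \<pi>0 q v c \<longleftrightarrow>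
     (\<forall>x. \<exists>m. is_min_value \<alpha> (\<pi>0 x) v m \<and> v x + c = q x + m)"

definition Gibbs_control :: "'x::finite pmf \<Rightarrow> ('x \<Rightarrow> real) \<Rightarrow> 'x \<Rightarrow> real" where
  "Gibbs_control p w x' = pmf p x' * exp (- w x') / (\<Sum>y\<in>UNIV. pmf p y * exp (- w y))"

end

(* Exponential tilting turns the objective into a single Renyi divergence: with
   P proportional to p * exp ((\<alpha> - 1) w) and U proportional to u * exp (\<alpha> w), the control cost
   D(p || u) plus the risk-sensitive expectation of w under u equals D(P || U) plus the constant
   Psi (\<alpha> - 1) p w. The Renyi divergence is nonnegative and vanishes only for P = U, that is,
   for u proportional to p * exp (- w); so the minimum is Psi (\<alpha> - 1) p w, which becomes linear
   after exponentiation. *)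
theory Submission
  imports Defs
begin

section \<open>Exponential tilting\<close>

lemma expectation_finite_type:
  fixes p :: "'x::finite pmf" and f :: "'x \<Rightarrow> real"
  shows "measure_pmf.expectation p f = (\<Sum>x\<in>UNIV. pmf p x * f x)"
  by (subst integral_measure_pmf_real[of UNIV]) (auto simp: mult.commute)

lemma expectation_exp_pos:
  fixes p :: "'x::finite pmf" and f :: "'x \<Rightarrow> real"
  shows "measure_pmf.expectation p (\<lambda>x. exp (f x)) > 0"
proof -
  obtain x where "x \<in> set_pmf p"
    using set_pmf_not_empty[of p] by blast
  then have "0 < pmf p x * exp (f x)"
    by (simp add: pmf_positive)
  also have "\<dots> \<le> (\<Sum>x\<in>UNIV. pmf p x * exp (f x))"
    by (rule member_le_sum) auto
  finally show ?thesis
    by (simp add: expectation_finite_type)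
qed

text \<open>The Esscher transform of \<open>p\<close>: an additive constant in \<open>f\<close>
  cancels against the normalization, so only differences of values of \<open>f\<close>
  matter.\<close>

definition tilt :: "'x::finite pmf \<Rightarrow> ('x \<Rightarrow> real) \<Rightarrow> 'x pmf" where
  "tilt p f =
     embed_pmf (\<lambda>x. pmf p x * exp (f x) / measure_pmf.expectation p (\<lambda>y. exp (f y)))"

lemma pmf_tilt:
  "pmf (tilt p f) x = pmf p x * exp (f x) / measure_pmf.expectation p (\<lambda>y. exp (f y))"
proof -
  let ?C = "measure_pmf.expectation p (\<lambda>y. exp (f y))"
  have C: "?C > 0" by (rule expectation_exp_pos)
  have "(\<Sum>x\<in>UNIV. pmf p x * exp (f x) / ?C) = 1"
    using C by (simp add: sum_divide_distrib[symmetric] expectation_finite_type)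
  \<comment> \<open>\<open>embed_pmf\<close> asks for total mass one as an extended nonnegative
    integral, so the real sum is transferred to \<open>ennreal\<close>.\<close>
  moreover have "(\<Sum>x\<in>UNIV. ennreal (pmf p x * exp (f x) / ?C)) =
      ennreal (\<Sum>x\<in>UNIV. pmf p x * exp (f x) / ?C)"
    using C by (intro sum_ennreal) auto
  ultimately show ?thesis
    unfolding tilt_def using C
    by (subst pmf_embed_pmf) (auto simp: nn_integral_count_space_finite)
qed

lemma set_pmf_tilt [simp]: "set_pmf (tilt p f) = set_pmf p"
  using expectation_exp_pos[of p f] by (auto simp: set_pmf_iff pmf_tilt)

lemma expectation_tilt:
  "measure_pmf.expectation (tilt p f) g =
     measure_pmf.expectation p (\<lambda>x. exp (f x) * g x) / measure_pmf.expectation p (\<lambda>x. exp (f x))"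
  by (simp add: expectation_finite_type[of "tilt p f"] expectation_finite_type[of p "\<lambda>x. exp (f x) * g x"]
      pmf_tilt sum_divide_distrib mult.assoc)

text \<open>The normalizers multiply to the one for \<open>f + g\<close>. Together with
  \<open>tilt_zero\<close> this makes tilting an action of the additive group of functions, so every
  tilt can be undone.\<close>

lemma tilt_tilt: "tilt (tilt p f) g = tilt p (\<lambda>x. f x + g x)"
  using expectation_exp_pos[of p f]
  by (intro pmf_eqI) (simp add: pmf_tilt expectation_tilt exp_add[symmetric] mult.assoc)

lemma tilt_zero: "tilt p (\<lambda>_. 0) = p"
  by (intro pmf_eqI) (simp add: pmf_tilt)

lemma tilt_eq_iff: "tilt p f = tilt u g \<longleftrightarrow> u = tilt p (\<lambda>x. f x - g x)"
proof
  assume "tilt p f = tilt u g"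
  then have "tilt (tilt p f) (\<lambda>x. - g x) = tilt (tilt u g) (\<lambda>x. - g x)" by simp
  then show "u = tilt p (\<lambda>x. f x - g x)" by (simp add: tilt_tilt tilt_zero)
qed (simp add: tilt_tilt)

lemma pmf_eq_Gibbs_control_iff:
  "(\<forall>x. pmf u x = Gibbs_control p w x) \<longleftrightarrow> u = tilt p (\<lambda>x. - w x)"
  by (simp add: pmf_eq_iff pmf_tilt Gibbs_control_def expectation_finite_type)

text \<open>Definedness depends on the supports only, and tilting preserves them.\<close>

lemma renyi_defined_tilt [simp]:
  "renyi_defined \<alpha> (tilt p f) (tilt u g) \<longleftrightarrow> renyi_defined \<alpha> p u"
  by (simp add: renyi_defined_def)

section \<open>Positivity of the Renyi divergence\<close>

text \<open>Gibbs' inequality. Subtracting \<open>pmf p x - pmf q x\<close> from each summand leaves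
  the total unchanged, both masses being one, and makes each summand nonnegative by
  \<open>ln s \<le> s - 1\<close>, where equality holds only at \<open>s = 1\<close>.\<close>

lemma KL_nonneg_eq_0:
  fixes p q :: "'x::finite pmf"
  assumes "set_pmf p \<subseteq> set_pmf q"
  shows "KL p q \<ge> 0" and "KL p q = 0 \<Longrightarrow> p = q"
proof -
  have summand: "pmf p x * ln (pmf p x / pmf q x) - (pmf p x - pmf q x) \<ge> 0 \<and>
      (pmf p x * ln (pmf p x / pmf q x) - (pmf p x - pmf q x) = 0 \<longrightarrow> pmf p x = pmf q x)" for x
  \<comment> \<open>Where \<open>p\<close> vanishes, the term reduces to \<open>pmf q x\<close>,
    which is zero only if the two masses agree.\<close>
  proof (cases "pmf p x = 0")
    case False
    then have p: "pmf p x > 0" and q: "pmf q x > 0"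
      using assms by (auto simp: set_pmf_iff pmf_positive)
    have eq: "pmf p x * ln (pmf p x / pmf q x) - (pmf p x - pmf q x) =
        pmf p x * ((pmf q x / pmf p x - 1) - ln (pmf q x / pmf p x))"
      using p q by (simp add: ln_div field_simps)
    show ?thesis
      unfolding eq using p q ln_le_minus_one[of "pmf q x / pmf p x"] ln_eq_minus_one[of "pmf q x / pmf p x"]
      by auto
  qed simp
  have KL: "KL p q = (\<Sum>x\<in>UNIV. pmf p x * ln (pmf p x / pmf q x) - (pmf p x - pmf q x))"
    by (simp add: KL_def sum_subtractf sum_pmf_eq_1)
  show "KL p q \<ge> 0"
    unfolding KL using summand by (intro sum_nonneg) auto
  assume "KL p q = 0"
  then have "\<forall>x. pmf p x * ln (pmf p x / pmf q x) - (pmf p x - pmf q x) = 0"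
    unfolding KL using summand by (subst (asm) sum_nonneg_eq_0_iff) auto
  then show "p = q"
    using summand by (auto intro: pmf_eqI)
qed

text \<open>
  The function of \<open>t\<close> below is the generator of the \<open>\<alpha>\<close>-divergence; its derivative
  \<open>(t powr (\<alpha> - 1) - 1) / (\<alpha> - 1)\<close> has the sign of \<open>t - 1\<close> for every \<open>\<alpha>\<close>.
\<close>

lemma alpha_divergence_generator_pos:
  fixes t \<alpha> :: real
  assumes "t > 0" "t \<noteq> 1" "\<alpha> \<noteq> 0" "\<alpha> \<noteq> 1"
  shows "(t powr \<alpha> - 1 - \<alpha> * (t - 1)) / (\<alpha> * (\<alpha> - 1)) > 0"
proof -
  define \<phi> where "\<phi> t = (t powr \<alpha> - 1 - \<alpha> * (t - 1)) / (\<alpha> * (\<alpha> - 1))" for t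
  define \<phi>' where "\<phi>' t = (t powr (\<alpha> - 1) - 1) / (\<alpha> - 1)" for t
  have der: "(\<phi> has_real_derivative \<phi>' s) (at s)" if "s > 0" for s
  proof -
    have "((\<lambda>t. t powr \<alpha> - 1 - \<alpha> * (t - 1)) has_real_derivative \<alpha> * (s powr (\<alpha> - 1) - 1)) (at s)"
      using that by (auto intro!: derivative_eq_intros simp: right_diff_distrib)
    from DERIV_cdivide[OF this, of "\<alpha> * (\<alpha> - 1)"] show ?thesis
      using assms by (simp add: \<phi>_def[abs_def] \<phi>'_def)
  qed
  have one: "\<phi> 1 = 0" by (simp add: \<phi>_def)
  have "\<phi> t > 0"
  \<comment> \<open>As \<phi> vanishes at 1, the mean value theorem expresses \<phi> at
    \<open>t\<close> as \<open>t - 1\<close> times the derivative at some \<open>s\<close> between 1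
    and \<open>t\<close>; both factors have the same sign.\<close>
  proof (cases "t > 1")
    case True
    obtain s where s: "1 < s" "s < t" "\<phi> t - \<phi> 1 = (t - 1) * \<phi>' s"
      using MVT2[OF True, of \<phi> \<phi>'] der by auto
    have "\<phi>' s > 0"
    \<comment> \<open>For \<alpha> below 1 the power is decreasing, but the denominator \<alpha> - 1
      is negative as well, so the sign of the quotient stays the same.\<close>
    proof (cases "\<alpha> > 1")
      case True
      then show ?thesis using s by (auto simp: \<phi>'_def intro!: divide_pos_pos)
    next
      case False
      have "s powr (\<alpha> - 1) < s powr 0"
        using s False assms by (intro powr_less_mono) auto
      then show ?thesis using False assms s by (auto simp: \<phi>'_def intro!: divide_neg_neg)
    qed
    then show ?thesis using s one True by simp
  next
    case False
    then have "t < 1" using assms by simp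
    then obtain s where s: "t < s" "s < 1" "\<phi> 1 - \<phi> t = (1 - t) * \<phi>' s"
      using MVT2[of t 1 \<phi> \<phi>'] der assms by auto
    have "s > 0" using s assms by simp
    have "\<phi>' s < 0"
    proof (cases "\<alpha> > 1")
      case True
      have "s powr (\<alpha> - 1) < s powr 0"
        using s \<open>s > 0\<close> True by (intro powr_less_mono') auto
      then show ?thesis using s \<open>s > 0\<close> True by (auto simp: \<phi>'_def intro!: divide_neg_pos)
    next
      case False
      have "s powr 0 < s powr (\<alpha> - 1)"
        using s \<open>s > 0\<close> False assms by (intro powr_less_mono') auto
      then show ?thesis using False assms s \<open>s > 0\<close> by (auto simp: \<phi>'_def intro!: divide_pos_neg)
    qed
    then have "(1 - t) * \<phi>' s < 0" using \<open>t < 1\<close> by (simp add: mult_pos_neg)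
    then show ?thesis using s one by simp
  qed
  then show ?thesis by (simp add: \<phi>_def)
qed

lemma sum_pmf_le_1: "finite A \<Longrightarrow> (\<Sum>x\<in>A. pmf p x) \<le> 1"
  by (simp add: measure_measure_pmf_finite[symmetric])

lemma set_pmf_subset_if_sum_eq_1:
  assumes "finite A" "(\<Sum>x\<in>A. pmf p x) = 1"
  shows "set_pmf p \<subseteq> A"
  using assms measure_pmf.prob_eq_1[of A p]
  by (auto simp: measure_measure_pmf_finite[symmetric] AE_measure_pmf_iff)

text \<open>In each range of \<alpha> definedness makes the two supports meet, so the logarithm in
  the divergence is taken of a positive number.\<close>

lemma renyi_sum_pos:
  fixes p q :: "'x::finite pmf"
  assumes "renyi_defined \<alpha> p q"
  shows "(\<Sum>x \<in> set_pmf p \<inter> set_pmf q. pmf p x powr \<alpha> * pmf q x powr (1 - \<alpha>)) > 0"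
proof -
  have "set_pmf p \<inter> set_pmf q \<noteq> {}"
    using assms set_pmf_not_empty[of p] set_pmf_not_empty[of q]
    by (cases "\<alpha> \<le> 0"; cases "\<alpha> \<ge> 1") (auto simp: renyi_defined_def)
  then show ?thesis
    by (intro sum_pos) (auto simp: set_pmf_iff)
qed

text \<open>Since \<open>ln A\<close> has the sign of \<open>A - 1\<close>, it suffices to study
  \<open>(A - 1) / k\<close>. This splits into a pointwise part \<open>a\<close> on the common
  support and two parts \<open>b\<close>, \<open>c\<close> for the mass of \<open>p\<close> and
  \<open>q\<close> outside it, all three nonnegative. If the divergence is zero, all three
  vanish.\<close>

lemma renyi_nonneg_eq_0_nondegenerate:
  fixes p q :: "'x::finite pmf"
  assumes def: "renyi_defined \<alpha> p q" and \<alpha>: "\<alpha> \<noteq> 0" "\<alpha> \<noteq> 1"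
  shows "renyi \<alpha> p q \<ge> 0" and "renyi \<alpha> p q = 0 \<Longrightarrow> p = q"
proof -
  define S where "S = set_pmf p \<inter> set_pmf q"
  define k where "k = \<alpha> * (\<alpha> - 1)"
  define A where "A = (\<Sum>x\<in>S. pmf p x powr \<alpha> * pmf q x powr (1 - \<alpha>))"
  \<comment> \<open>This is \<open>pmf q x\<close> times the generator of the \<alpha>-divergence at
    the ratio \<open>pmf p x / pmf q x\<close>.\<close>
  define \<phi> where "\<phi> x = (pmf p x powr \<alpha> * pmf q x powr (1 - \<alpha>) - \<alpha> * pmf p x - (1 - \<alpha>) * pmf q x) / k" for x
  have k: "k \<noteq> 0" using \<alpha> by (simp add: k_def)
  have A: "A > 0" using renyi_sum_pos[OF def] by (simp add: A_def S_def)
  have \<phi>_pos: "\<phi> x > 0" if "x \<in> S" "pmf p x \<noteq> pmf q x" for x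
  proof -
    have p: "pmf p x > 0" and q: "pmf q x > 0"
      using that by (auto simp: S_def pmf_positive)
    have "pmf p x powr \<alpha> * pmf q x powr (1 - \<alpha>) = pmf q x * (pmf p x / pmf q x) powr \<alpha>"
      using p q by (simp add: powr_divide powr_diff)
    moreover have "pmf q x * (R - 1 - \<alpha> * (pmf p x / pmf q x - 1)) =
        pmf q x * R - \<alpha> * pmf p x - (1 - \<alpha>) * pmf q x" for R
      using q by (simp add: field_simps)
    ultimately have "\<phi> x = pmf q x * (((pmf p x / pmf q x) powr \<alpha> - 1 - \<alpha> * (pmf p x / pmf q x - 1)) / k)"
      by (simp add: \<phi>_def)
    moreover have "((pmf p x / pmf q x) powr \<alpha> - 1 - \<alpha> * (pmf p x / pmf q x - 1)) / k > 0"
      unfolding k_def using p q that \<alpha> by (intro alpha_divergence_generator_pos) auto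
    ultimately show ?thesis using q by (simp only: mult_pos_pos)
  qed
  have \<phi>_eq: "\<phi> x = 0" if "x \<in> S" "pmf p x = pmf q x" for x
    using that pmf_positive[of x q] by (auto simp: \<phi>_def S_def powr_add[symmetric] algebra_simps)
  have \<phi>_nonneg: "\<phi> x \<ge> 0" if "x \<in> S" for x
    using \<phi>_pos[OF that] \<phi>_eq[OF that] by fastforce
  define a where "a = (\<Sum>x\<in>S. \<phi> x)"
  define b where "b = (1 - (\<Sum>x\<in>S. pmf p x)) / (1 - \<alpha>)"
  define c where "c = (1 - (\<Sum>x\<in>S. pmf q x)) / \<alpha>"
  have sum_\<phi>: "(\<Sum>x\<in>S. \<phi> x) = (A - \<alpha> * (\<Sum>x\<in>S. pmf p x) - (1 - \<alpha>) * (\<Sum>x\<in>S. pmf q x)) / k"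
    by (simp add: \<phi>_def A_def sum_divide_distrib[symmetric] sum_subtractf sum_distrib_left[symmetric])
  have "b = \<alpha> * ((\<Sum>x\<in>S. pmf p x) - 1) / k"
    using \<alpha> minus_divide_divide[of "1 - (\<Sum>x\<in>S. pmf p x)" "1 - \<alpha>"] by (simp add: b_def k_def)
  moreover have "c = (\<alpha> - 1) * (1 - (\<Sum>x\<in>S. pmf q x)) / k"
    using \<alpha> by (simp add: c_def k_def)
  \<comment> \<open>The coefficients \<alpha> and 1 - \<alpha> add up to 1, so the constant 1 is
    shared out between the two mass deficits.\<close>
  ultimately have decomp: "(A - 1) / k = a + b + c"
    unfolding a_def sum_\<phi> by (simp only: add_divide_distrib[symmetric]) (simp add: algebra_simps)
  have a: "a \<ge> 0" unfolding a_def by (intro sum_nonneg \<phi>_nonneg)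
  \<comment> \<open>The divisor of \<open>b\<close> is negative exactly for \<alpha> > 1, that of
    \<open>c\<close> exactly for \<alpha> < 0; there the inclusion of supports makes the
    corresponding deficit zero.\<close>
  have full_p: "(\<Sum>x\<in>S. pmf p x) = 1" if "\<alpha> > 1"
    using that def by (intro sum_pmf_eq_1) (auto simp: S_def renyi_defined_def)
  have full_q: "(\<Sum>x\<in>S. pmf q x) = 1" if "\<alpha> < 0"
    using that def by (intro sum_pmf_eq_1) (auto simp: S_def renyi_defined_def)
  have b: "b \<ge> 0" using full_p sum_pmf_le_1[of S p] \<alpha>
    by (cases "\<alpha> > 1") (auto simp: b_def)
  have c: "c \<ge> 0" using full_q sum_pmf_le_1[of S q] \<alpha>
    by (cases "\<alpha> < 0") (auto simp: c_def)
  have renyi: "renyi \<alpha> p q = ln A / k"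
    using \<alpha> by (simp add: renyi_def A_def S_def k_def)
  have "(A - 1) / k \<ge> 0" using a b c decomp by simp
  then show "renyi \<alpha> p q \<ge> 0"
    unfolding renyi using A k by (auto simp: zero_le_divide_iff)
  assume "renyi \<alpha> p q = 0"
  then have "A = 1" using k A by (simp add: renyi)
  then have "a = 0" "b = 0" "c = 0" using a b c decomp by auto
  have "\<forall>x\<in>S. \<phi> x = 0"
    using \<open>a = 0\<close> \<phi>_nonneg unfolding a_def by (subst (asm) sum_nonneg_eq_0_iff) auto
  then have "\<forall>x\<in>S. pmf p x = pmf q x" using \<phi>_pos by fastforce
  \<comment> \<open>Zero deficits confine both supports to \<open>S\<close>, so outside
    \<open>S\<close> both masses are zero.\<close>
  moreover have "(\<Sum>x\<in>S. pmf p x) = 1" "(\<Sum>x\<in>S. pmf q x) = 1"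
    using \<open>b = 0\<close> \<open>c = 0\<close> \<alpha> by (simp_all add: b_def c_def)
  then have "set_pmf p \<subseteq> S" "set_pmf q \<subseteq> S"
    by (simp_all add: set_pmf_subset_if_sum_eq_1)
  ultimately show "p = q"
    by (intro pmf_eqI) (metis set_pmf_iff subsetD)
qed

lemma renyi_nonneg:
  assumes "renyi_defined \<alpha> p q"
  shows "renyi \<alpha> p q \<ge> 0"
proof -
  consider "\<alpha> = 0" | "\<alpha> = 1" | "\<alpha> \<noteq> 0" "\<alpha> \<noteq> 1" by blast
  then show ?thesis
    using assms renyi_nonneg_eq_0_nondegenerate(1)[OF assms] KL_nonneg_eq_0(1)[of p q] KL_nonneg_eq_0(1)[of q p]
    by cases (auto simp: renyi_def renyi_defined_def)
qed

lemma renyi_self: "renyi \<alpha> p p = 0"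
proof -
  have *: "(\<Sum>x\<in>set_pmf p. pmf p x powr \<alpha> * pmf p x powr (1 - \<alpha>)) = (\<Sum>x\<in>set_pmf p. pmf p x)"
    by (intro sum.cong) (auto simp: powr_add[symmetric])
  have "pmf p x * ln (pmf p x / pmf p x) = 0" for x
    by (cases "pmf p x = 0") auto
  then have "KL p p = 0"
    unfolding KL_def by (intro sum.neutral) blast
  with * show ?thesis
    by (simp add: renyi_def sum_pmf_eq_1)
qed

lemma renyi_eq_0_iff:
  assumes "renyi_defined \<alpha> p q"
  shows "renyi \<alpha> p q = 0 \<longleftrightarrow> p = q"
proof
  assume 0: "renyi \<alpha> p q = 0"
  consider "\<alpha> = 0" | "\<alpha> = 1" | "\<alpha> \<noteq> 0" "\<alpha> \<noteq> 1" by blast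
  then show "p = q"
    using assms 0 renyi_nonneg_eq_0_nondegenerate(2)[OF assms] KL_nonneg_eq_0(2)[of p q] KL_nonneg_eq_0(2)[of q p]
    by cases (auto simp: renyi_def renyi_defined_def)
qed (simp add: renyi_self)

section \<open>The minimum of the objective\<close>

text \<open>Tilting \<open>q\<close> adds \<open>f\<close> minus the log-normalizer to its
  log-density, and this is averaged under \<open>p\<close>. The trivial tilt of \<open>p\<close> is
  kept because for \<alpha> equal to 0 or 1 one of the two tilting functions of the general identity
  becomes zero.\<close>

lemma KL_tilt_left:
  assumes "set_pmf p \<subseteq> set_pmf q"
  shows "KL (tilt p (\<lambda>_. 0)) (tilt q f) =
    KL p q - measure_pmf.expectation p f + ln (measure_pmf.expectation q (\<lambda>x. exp (f x)))"
proof -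
  let ?C = "measure_pmf.expectation q (\<lambda>x. exp (f x))"
  have C: "?C > 0" by (rule expectation_exp_pos)
  have "pmf p x * ln (pmf p x / pmf (tilt q f) x) =
      pmf p x * ln (pmf p x / pmf q x) - pmf p x * f x + pmf p x * ln ?C" for x
  proof (cases "pmf p x = 0")
    case False
    then have "pmf p x > 0" "pmf q x > 0"
      using assms by (auto simp: set_pmf_iff pmf_positive)
    then show ?thesis
      using C by (simp add: pmf_tilt ln_div ln_mult algebra_simps)
  qed simp
  then show ?thesis
    by (simp add: tilt_zero KL_def sum.distrib sum_subtractf expectation_finite_type[of p]
        sum_distrib_right[symmetric] sum_pmf_eq_1)
qed

text \<open>The tilts by (\<alpha> - 1) w and \<alpha> w, raised to the powers \<alpha> and 1 -
  \<alpha>, cancel pointwise. Only the normalizers survive, and their logarithms are the two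
  \<open>Psi\<close> terms. For \<alpha> equal to 0 or 1 the identity is a change of measure in
  \<open>KL\<close>.\<close>

lemma objective_eq_renyi_tilt:
  fixes p u :: "'x::finite pmf"
  assumes "renyi_defined \<alpha> p u"
  shows "objective \<alpha> p w u =
    Psi (\<alpha> - 1) p w + renyi \<alpha> (tilt p (\<lambda>x. (\<alpha> - 1) * w x)) (tilt u (\<lambda>x. \<alpha> * w x))"
proof -
  consider "\<alpha> = 0" | "\<alpha> = 1" | "\<alpha> \<noteq> 0" "\<alpha> \<noteq> 1" by blast
  then show ?thesis
  proof cases
    case 1
    then have "set_pmf u \<subseteq> set_pmf p" using assms by (simp add: renyi_defined_def)
    \<comment> \<open>Order zero swaps the arguments of \<open>KL\<close>: the control stands on the
      left with zero tilt, and \<open>p\<close> is tilted by \<open>- w\<close>.\<close>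
    from KL_tilt_left[OF this, of "\<lambda>x. - w x"] 1 show ?thesis
      by (simp add: objective_def renyi_def Psi_def)
  next
    case 2
    then have "set_pmf p \<subseteq> set_pmf u" using assms by (simp add: renyi_defined_def)
    from KL_tilt_left[OF this, of w] 2 show ?thesis
      by (simp add: objective_def renyi_def Psi_def)
  next
    case 3
    define S where "S = set_pmf p \<inter> set_pmf u"
    define A where "A = (\<Sum>x\<in>S. pmf p x powr \<alpha> * pmf u x powr (1 - \<alpha>))"
    define B where "B = measure_pmf.expectation u (\<lambda>x. exp (\<alpha> * w x))"
    define C where "C = measure_pmf.expectation p (\<lambda>x. exp ((\<alpha> - 1) * w x))"
    let ?P = "tilt p (\<lambda>x. (\<alpha> - 1) * w x)" and ?U = "tilt u (\<lambda>x. \<alpha> * w x)"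
    have pos: "A > 0" "B > 0" "C > 0"
      using renyi_sum_pos[OF assms] expectation_exp_pos by (auto simp: A_def S_def B_def C_def)
    have "pmf ?P x powr \<alpha> * pmf ?U x powr (1 - \<alpha>) =
        pmf p x powr \<alpha> * pmf u x powr (1 - \<alpha>) * (C powr (- \<alpha>) * B powr (\<alpha> - 1))" for x
    proof -
      have P: "pmf ?P x = pmf p x * exp ((\<alpha> - 1) * w x) / C"
        and U: "pmf ?U x = pmf u x * exp (\<alpha> * w x) / B"
        by (simp_all add: pmf_tilt B_def C_def)
      have "pmf ?P x powr \<alpha> = pmf p x powr \<alpha> * exp ((\<alpha> - 1) * w x * \<alpha>) * C powr (- \<alpha>)"
        using pos by (simp add: P powr_divide powr_mult powr_minus_divide exp_powr_real)
      moreover have "pmf ?U x powr (1 - \<alpha>) =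
          pmf u x powr (1 - \<alpha>) * exp (\<alpha> * w x * (1 - \<alpha>)) * B powr (\<alpha> - 1)"
        using pos powr_minus_divide[of B "1 - \<alpha>"]
        by (simp add: U powr_divide powr_mult exp_powr_real)
      moreover have "\<alpha> * w x * (1 - \<alpha>) = - ((\<alpha> - 1) * w x * \<alpha>)"
        by (simp add: algebra_simps)
      ultimately show ?thesis by (simp add: exp_minus)
    qed
    then have "(\<Sum>x\<in>S. pmf ?P x powr \<alpha> * pmf ?U x powr (1 - \<alpha>)) =
        A * (C powr (- \<alpha>) * B powr (\<alpha> - 1))"
      by (simp add: A_def sum_distrib_right)
    then have "renyi \<alpha> ?P ?U = (ln A + (- \<alpha> * ln C + (\<alpha> - 1) * ln B)) / (\<alpha> * (\<alpha> - 1))"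
      using 3 pos by (simp add: renyi_def S_def[symmetric] ln_mult ln_powr)
    moreover have "objective \<alpha> p w u = ln A / (\<alpha> * (\<alpha> - 1)) + ln B / \<alpha>"
      using 3 by (simp add: objective_def renyi_def Psi_def A_def S_def B_def)
    moreover have "Psi (\<alpha> - 1) p w = ln C / (\<alpha> - 1)"
      using 3 by (simp add: Psi_def C_def)
    \<comment> \<open>The normalizer of \<open>p\<close> contributes
      \<open>- Psi (\<alpha> - 1) p w\<close>, that of \<open>u\<close> contributes
      \<open>Psi \<alpha> u w\<close>.\<close>
    moreover have "- \<alpha> * ln C / (\<alpha> * (\<alpha> - 1)) = - (ln C / (\<alpha> - 1))"
      "(\<alpha> - 1) * ln B / (\<alpha> * (\<alpha> - 1)) = ln B / \<alpha>"
      using 3 by simp_all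
    ultimately show ?thesis
      by (simp only: add_divide_distrib)
  qed
qed

text \<open>Tilting this control further by \<alpha> w gives the tilt of \<open>p\<close> by
  (\<alpha> - 1) w, so the remaining divergence is that of a distribution from itself.\<close>

lemma objective_tilt:
  "objective \<alpha> p w (tilt p (\<lambda>x. - w x)) = Psi (\<alpha> - 1) p w"
  "tilt p (\<lambda>x. - w x) \<in> admissible \<alpha> p"
proof -
  have def: "renyi_defined \<alpha> p (tilt p (\<lambda>x. - w x))"
    using set_pmf_not_empty[of p] by (auto simp: renyi_defined_def)
  then show "tilt p (\<lambda>x. - w x) \<in> admissible \<alpha> p" by (simp add: admissible_def)
  show "objective \<alpha> p w (tilt p (\<lambda>x. - w x)) = Psi (\<alpha> - 1) p w"
    unfolding objective_eq_renyi_tilt[OF def]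
    by (simp add: tilt_tilt algebra_simps renyi_self)
qed

lemma objective_ge:
  assumes "u \<in> admissible \<alpha> p"
  shows "objective \<alpha> p w u \<ge> Psi (\<alpha> - 1) p w"
  using assms by (simp add: admissible_def objective_eq_renyi_tilt renyi_nonneg)

text \<open>Equality means zero divergence, hence equal tilted distributions; undoing the tilt of
  \<open>u\<close> determines \<open>u\<close>.\<close>

lemma objective_eq_iff:
  assumes "u \<in> admissible \<alpha> p"
  shows "objective \<alpha> p w u = Psi (\<alpha> - 1) p w \<longleftrightarrow> u = tilt p (\<lambda>x. - w x)"
  using assms
  by (simp add: admissible_def objective_eq_renyi_tilt renyi_eq_0_iff tilt_eq_iff algebra_simps)

text \<open>The risk parameter drops out of the minimizer because (\<alpha> - 1) w - \<alpha> w = -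
  w.\<close>

lemma optimal_control_iff: "optimal_control \<alpha> p w u \<longleftrightarrow> u = tilt p (\<lambda>x. - w x)"
proof
  assume "optimal_control \<alpha> p w u"
  then have u: "u \<in> admissible \<alpha> p"
    and "\<not> objective \<alpha> p w (tilt p (\<lambda>x. - w x)) < objective \<alpha> p w u"
    using objective_tilt(2) by (auto simp: optimal_control_def is_arg_min_def)
  then have "objective \<alpha> p w u = Psi (\<alpha> - 1) p w"
    using objective_ge[OF u, of w] by (simp add: objective_tilt)
  then show "u = tilt p (\<lambda>x. - w x)" using objective_eq_iff[OF u] by blast
next
  assume u: "u = tilt p (\<lambda>x. - w x)"
  have "\<not> objective \<alpha> p w u' < objective \<alpha> p w u" if "u' \<in> admissible \<alpha> p" for u'
    unfolding u objective_tilt not_less using that by (rule objective_ge)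
  then show "optimal_control \<alpha> p w u"
    using objective_tilt(2) unfolding optimal_control_def is_arg_min_def u by blast
qed

lemma optimal_control_iff_Gibbs:
  "optimal_control \<alpha> p w u \<longleftrightarrow> (\<forall>x. pmf u x = Gibbs_control p w x)"
  by (simp add: optimal_control_iff pmf_eq_Gibbs_control_iff)

section \<open>Linearization of the Bellman equations\<close>

lemma is_min_value_iff: "is_min_value \<alpha> p w m \<longleftrightarrow> m = Psi (\<alpha> - 1) p w"
  by (simp add: is_min_value_def optimal_control_iff objective_tilt)

text \<open>Multiplication by \<alpha> - 1, which is nonzero, and \<open>exp\<close> are injective,
  and together they turn \<open>Psi (\<alpha> - 1)\<close> into a plain expectation and the sum into
  a product.\<close>

lemma eq_add_Psi_iff_exp:
  assumes "\<alpha> \<noteq> 1"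
  shows "a = b + Psi (\<alpha> - 1) p w \<longleftrightarrow>
    exp (- (1 - \<alpha>) * a) =
      exp (- (1 - \<alpha>) * b) * measure_pmf.expectation p (\<lambda>x. exp (- (1 - \<alpha>) * w x))"
proof -
  let ?E = "measure_pmf.expectation p (\<lambda>x. exp ((\<alpha> - 1) * w x))"
  have "(\<alpha> - 1) * Psi (\<alpha> - 1) p w = ln ?E"
    using assms by (simp add: Psi_def)
  then have E: "?E = exp ((\<alpha> - 1) * Psi (\<alpha> - 1) p w)"
    using expectation_exp_pos[of p "\<lambda>x. (\<alpha> - 1) * w x"] by (simp only: exp_ln)
  have "exp ((\<alpha> - 1) * b) * ?E = exp ((\<alpha> - 1) * (b + Psi (\<alpha> - 1) p w))"
    unfolding E by (simp only: exp_add distrib_left)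
  moreover have "- (1 - \<alpha>) = \<alpha> - 1" by simp
  ultimately show ?thesis
    using assms by (simp only: exp_inj_iff mult_cancel_left) simp
qed

lemma bellman_FH_iff:
  "bellman_FH \<alpha> \<pi>0 T q v \<longleftrightarrow>
     (\<forall>x. \<forall>t<T. v t x = q x t + Psi (\<alpha> - 1) (\<pi>0 x) (v (Suc t))) \<and> (\<forall>x. v T x = q x T)"
  by (simp add: bellman_FH_def is_min_value_iff)

lemma bellman_FE_iff:
  "bellman_FE \<alpha> \<pi>0 \<N> \<T> q v \<longleftrightarrow>
     (\<forall>x\<in>\<N>. v x = q x + Psi (\<alpha> - 1) (\<pi>0 x) v) \<and> (\<forall>x\<in>\<T>. v x = q x)"
  by (simp add: bellman_FE_def is_min_value_iff)

text \<open>The average cost is absorbed into the state cost to reach the shape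
  \<open>a = b + Psi (\<alpha> - 1) p w\<close>.\<close>

lemma bellman_IH_iff:
  "bellman_IH \<alpha> \<pi>0 q v c \<longleftrightarrow> (\<forall>x. v x = (q x - c) + Psi (\<alpha> - 1) (\<pi>0 x) v)"
  by (simp add: bellman_IH_def is_min_value_iff algebra_simps)

theorem theorem1:
  fixes \<alpha> :: real and \<pi>0 :: "'x::finite \<Rightarrow> 'x pmf"
  shows
    "(\<alpha> \<noteq> 1 \<longrightarrow>
       (\<forall>(T::nat) (q :: 'x \<Rightarrow> nat \<Rightarrow> real) (v :: nat \<Rightarrow> 'x \<Rightarrow> real) Q z.
          Q = (\<lambda>x t. exp (- (1 - \<alpha>) * q x t)) \<longrightarrow>
          z = (\<lambda>t x. exp (- (1 - \<alpha>) * v t x)) \<longrightarrow>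
          (bellman_FH \<alpha> \<pi>0 T q v \<longleftrightarrow>
             (\<forall>x. \<forall>t<T. z t x = Q x t * measure_pmf.expectation (\<pi>0 x) (z (Suc t))) \<and>
             (\<forall>x. z T x = Q x T))) \<and>
       (\<forall>(\<N> :: 'x set) (\<T> :: 'x set) (q :: 'x \<Rightarrow> real) (v :: 'x \<Rightarrow> real) Q z.
          \<N> \<union> \<T> = UNIV \<longrightarrow> \<N> \<inter> \<T> = {} \<longrightarrow>
          Q = (\<lambda>x. exp (- (1 - \<alpha>) * q x)) \<longrightarrow>
          z = (\<lambda>x. exp (- (1 - \<alpha>) * v x)) \<longrightarrow>
          (bellman_FE \<alpha> \<pi>0 \<N> \<T> q v \<longleftrightarrow>
             (\<forall>x\<in>\<N>. z x = Q x * measure_pmf.expectation (\<pi>0 x) z) \<and>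
             (\<forall>x\<in>\<T>. z x = Q x))) \<and>
       (\<forall>(q :: 'x \<Rightarrow> real) (v :: 'x \<Rightarrow> real) (c::real) Q z.
          Q = (\<lambda>x. exp (- (1 - \<alpha>) * q x)) \<longrightarrow>
          z = (\<lambda>x. exp (- (1 - \<alpha>) * v x)) \<longrightarrow>
          (bellman_IH \<alpha> \<pi>0 q v c \<longleftrightarrow>
             (\<forall>x. z x = Q x * exp (- (\<alpha> - 1) * c) * measure_pmf.expectation (\<pi>0 x) z)))) \<and>
     (\<alpha> = 1 \<longrightarrow>
       (\<forall>(T::nat) (q :: 'x \<Rightarrow> nat \<Rightarrow> real) (v :: nat \<Rightarrow> 'x \<Rightarrow> real).
          bellman_FH \<alpha> \<pi>0 T q v \<longleftrightarrow>
            (\<forall>x. \<forall>t<T. v t x = q x t + measure_pmf.expectation (\<pi>0 x) (v (Suc t))) \<and>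
            (\<forall>x. v T x = q x T)) \<and>
       (\<forall>(\<N> :: 'x set) (\<T> :: 'x set) (q :: 'x \<Rightarrow> real) (v :: 'x \<Rightarrow> real).
          \<N> \<union> \<T> = UNIV \<longrightarrow> \<N> \<inter> \<T> = {} \<longrightarrow>
          (bellman_FE \<alpha> \<pi>0 \<N> \<T> q v \<longleftrightarrow>
             (\<forall>x\<in>\<N>. v x = q x + measure_pmf.expectation (\<pi>0 x) v) \<and>
             (\<forall>x\<in>\<T>. v x = q x))) \<and>
       (\<forall>(q :: 'x \<Rightarrow> real) (v :: 'x \<Rightarrow> real) (c::real).
          bellman_IH \<alpha> \<pi>0 q v c \<longleftrightarrow>
            (\<forall>x. v x + c = q x + measure_pmf.expectation (\<pi>0 x) v))) \<and>
     (\<forall>(T::nat) (q :: 'x \<Rightarrow> nat \<Rightarrow> real) (v :: nat \<Rightarrow> 'x \<Rightarrow> real).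
        bellman_FH \<alpha> \<pi>0 T q v \<longrightarrow>
        (\<forall>x. \<forall>t<T. \<forall>u. optimal_control \<alpha> (\<pi>0 x) (v (Suc t)) u \<longleftrightarrow>
           (\<forall>x'. pmf u x' = Gibbs_control (\<pi>0 x) (v (Suc t)) x'))) \<and>
     (\<forall>(\<N> :: 'x set) (\<T> :: 'x set) (q :: 'x \<Rightarrow> real) (v :: 'x \<Rightarrow> real).
        \<N> \<union> \<T> = UNIV \<longrightarrow> \<N> \<inter> \<T> = {} \<longrightarrow> bellman_FE \<alpha> \<pi>0 \<N> \<T> q v \<longrightarrow>
        (\<forall>x\<in>\<N>. \<forall>u. optimal_control \<alpha> (\<pi>0 x) v u \<longleftrightarrow>
           (\<forall>x'. pmf u x' = Gibbs_control (\<pi>0 x) v x'))) \<and>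
     (\<forall>(q :: 'x \<Rightarrow> real) (v :: 'x \<Rightarrow> real) (c::real).
        bellman_IH \<alpha> \<pi>0 q v c \<longrightarrow>
        (\<forall>x u. optimal_control \<alpha> (\<pi>0 x) v u \<longleftrightarrow>
           (\<forall>x'. pmf u x' = Gibbs_control (\<pi>0 x) v x')))"
proof -
  \<comment> \<open>For the terminal conditions, which contain no expectation.\<close>
  have exp_eq: "a = b \<longleftrightarrow> exp (- (1 - \<alpha>) * a) = exp (- (1 - \<alpha>) * b)" if "\<alpha> \<noteq> 1" for a b
    using that by simp
  have exp_cost: "exp (- (1 - \<alpha>) * (b - c)) = exp (- (1 - \<alpha>) * b) * exp (- (\<alpha> - 1) * c)" for b c
    by (simp add: exp_add[symmetric] algebra_simps)
  \<comment> \<open>At \<alpha> = 1 the minimum is \<open>Psi 0\<close>, so the equations are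
    already linear in the value function.\<close>
  have Psi_0: "Psi 0 p w = measure_pmf.expectation p w" for p :: "'x pmf" and w
    by (simp add: Psi_def)
  show ?thesis
  proof (intro conjI impI allI, goal_cases)
    case (1 T q v Q z)
    show ?case unfolding bellman_FH_iff 1 eq_add_Psi_iff_exp[OF 1(1)] exp_eq[OF 1(1), of "v T _" "q _ T"] ..
  next
    case (2 \<N> \<T> q v Q z)
    show ?case unfolding bellman_FE_iff 2(4,5) eq_add_Psi_iff_exp[OF 2(1)] exp_eq[OF 2(1), of "v _" "q _"] ..
  next
    case (3 q v c Q z)
    show ?case unfolding bellman_IH_iff 3(2,3) eq_add_Psi_iff_exp[OF 3(1)] exp_cost ..
  \<comment> \<open>Six cases are left: the three equations at \<alpha> = 1 and the three control
    laws.\<close>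
  qed (auto simp: bellman_FH_iff bellman_FE_iff bellman_IH_iff Psi_0 optimal_control_iff_Gibbs algebra_simps)
qed

end
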